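(* (Green's formula; self-adjoint operator.) Let $a<b$ with $[a,b]\subseteq\mathcal I$. If $x,y\in\mathbb D$, then $$\langle x,Ly\rangle-\langle Lx,y\rangle=e_0^2(b,t)\,p(t)\,W(x,y)(t)\Big|_{t=a}^{b}.$$ Moreover, $L$ is formally self-adjoint with respect to the inner product $\langle\cdot,\cdot\rangle$; that is, for $x,y\in\mathbb D$ the identity $$\langle Lx,y\rangle=\langle x,Ly\rangle$$ holds if and only if $x,y$ satisfy the self-adjoint boundary conditions $$e_0^2(b,t)\,p(t)\,W(x,y)(t)\Big|_{t=a}^{b}=0.$$
   Context: $\mathcal I\subseteq\mathbb R$ is a nondegenerate interval. The functions $\kappa_0,\kappa_1:[0,1]\times\mathcal I\to[0,\infty)$ are continuous and satisfy, for all $t\in\mathcal I$: $\lim_{\alpha\to0^+}\kappa_1(\alpha,t)=1$, $\lim_{\alpha\to0^+}\kappa_0(\alpha,t)=0$, $\lim_{\alpha\to1^-}\kappa_1(\alpha,t)=0$, $\lim_{\alpha\to1^-}\kappa_0(\alpha,t)=1$, $\kappa_1(\alpha,t)\ne0$ for $\alpha\in[0,1)$, and $\kappa_0(\alpha,t)\neq0$ for $\alpha\in(0,1]$. Fix $\alpha\in(0,1]$ and write $\kappa_j(t)=\kappa_j(\alpha,t)$. The conformable (proportional) derivative is $D^{\alpha}f(t)=\kappa_1(t)f(t)+\kappa_0(t)f'(t)$. Write $d_\alpha t=dt/\kappa_0(t)$ and, for $t,s\in\mathcal I$, $e_0(t,s)=\exp\left(-\int_s^t\frac{\kappa_1(\tau)}{\kappa_0(\tau)}\,d\tau\right)$;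 $e_0^2(t,s)=(e_0(t,s))^2$. Let $p,q$ be continuous on $\mathcal I$ with $p(t)>0$ for all $t\in\mathcal I$, and set $Lx=D^{\alpha}[pD^{\alpha}x]+qx$. $\mathbb D$ is the set of all continuous functions $x$ on $\mathcal I$ such that $D^{\alpha}x$ and $D^{\alpha}[pD^{\alpha}x]$ exist and are continuous on $\mathcal I$. The conformable Wronskian is $W(x,y)=xD^{\alpha}y-yD^{\alpha}x$. The inner product of continuous functions $f,g$ on $[a,b]$ is $\langle f,g\rangle=\int_a^b f(t)g(t)e_0^2(b,t)\,d_\alpha t$. *)

theory Defs
  imports "HOL-Analysis.Analysis"
begin

text \<open>
  Throughout, \<open>k0\<close> and \<open>k1\<close> are the slices \<open>\<kappa>0 \<alpha>\<close> and \<open>\<kappa>1 \<alpha>\<close> for a fixed order \<open>\<alpha>\<close>.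
  Functions on the interval \<open>I\<close> are total functions of which only the values on \<open>I\<close> matter:
  derivatives are taken within \<open>I\<close>, hence one-sided at an endpoint belonging to \<open>I\<close>.
\<close>

definition conf_deriv ::
  "(real \<Rightarrow> real) \<Rightarrow> (real \<Rightarrow> real) \<Rightarrow> real set \<Rightarrow> (real \<Rightarrow> real) \<Rightarrow> real \<Rightarrow> real" where
  "conf_deriv k0 k1 I f t = k1 t * f t + k0 t * vector_derivative f (at t within I)"

text \<open>The right-hand side of \<open>conf_deriv\<close> makes sense exactly where the ordinary derivative exists.\<close>

definition conf_differentiable_on :: "real set \<Rightarrow> (real \<Rightarrow> real) \<Rightarrow> bool" where
  "conf_differentiable_on I f \<longleftrightarrow> (\<forall>t\<in>I. f differentiable (at t within I))"

text \<open>\<open>LBINT \<tau>=s..t\<close> is oriented, so \<open>t < s\<close> is allowed.\<close>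

definition conf_exp0 :: "(real \<Rightarrow> real) \<Rightarrow> (real \<Rightarrow> real) \<Rightarrow> real \<Rightarrow> real \<Rightarrow> real" where
  "conf_exp0 k0 k1 t s = exp (- (LBINT \<tau>=ereal s..ereal t. k1 \<tau> / k0 \<tau>))"

definition conf_L ::
  "(real \<Rightarrow> real) \<Rightarrow> (real \<Rightarrow> real) \<Rightarrow> real set \<Rightarrow> (real \<Rightarrow> real) \<Rightarrow> (real \<Rightarrow> real) \<Rightarrow>
    (real \<Rightarrow> real) \<Rightarrow> real \<Rightarrow> real" where
  "conf_L k0 k1 I p q x t =
     conf_deriv k0 k1 I (\<lambda>s. p s * conf_deriv k0 k1 I x s) t + q t * x t"

definition conf_domain ::
  "(real \<Rightarrow> real) \<Rightarrow> (real \<Rightarrow> real) \<Rightarrow> real set \<Rightarrow> (real \<Rightarrow> real) \<Rightarrow> (real \<Rightarrow> real) set" where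
  "conf_domain k0 k1 I p =
     {x. continuous_on I x \<and>
         conf_differentiable_on I x \<and>
         continuous_on I (conf_deriv k0 k1 I x) \<and>
         conf_differentiable_on I (\<lambda>s. p s * conf_deriv k0 k1 I x s) \<and>
         continuous_on I (conf_deriv k0 k1 I (\<lambda>s. p s * conf_deriv k0 k1 I x s))}"

definition conf_wronskian ::
  "(real \<Rightarrow> real) \<Rightarrow> (real \<Rightarrow> real) \<Rightarrow> real set \<Rightarrow> (real \<Rightarrow> real) \<Rightarrow> (real \<Rightarrow> real) \<Rightarrow>
    real \<Rightarrow> real" where
  "conf_wronskian k0 k1 I x y t =
     x t * conf_deriv k0 k1 I y t - y t * conf_deriv k0 k1 I x t"

text \<open>The factor \<open>1 / k0 t\<close> comes from \<open>d\<^sub>\<alpha>t = dt / k0 t\<close>.\<close>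

definition conf_inner ::
  "(real \<Rightarrow> real) \<Rightarrow> (real \<Rightarrow> real) \<Rightarrow> real \<Rightarrow> real \<Rightarrow> (real \<Rightarrow> real) \<Rightarrow> (real \<Rightarrow> real) \<Rightarrow>
    real" where
  "conf_inner k0 k1 a b f g =
     (LBINT t=ereal a..ereal b. f t * g t * (conf_exp0 k0 k1 b t)\<^sup>2 / k0 t)"

definition eval_between :: "(real \<Rightarrow> real) \<Rightarrow> real \<Rightarrow> real \<Rightarrow> real" where
  "eval_between F a b = F b - F a"

end

theory Submission
  imports Defs
begin

text \<open>
  Write \<open>P = p D\<^sup>\<alpha>x\<close>, \<open>Q = p D\<^sup>\<alpha>y\<close> and \<open>E(t) = e\<^sub>0\<^sup>2(b,t)\<close>, so that \<open>E' = 2 (\<kappa>\<^sub>1/\<kappa>\<^sub>0) E\<close> and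
  \<open>p W(x,y) = x Q - y P\<close>.  Replacing each ordinary derivative by \<open>f' = (D\<^sup>\<alpha>f - \<kappa>\<^sub>1 f)/\<kappa>\<^sub>0\<close> in
  \<open>(E (x Q - y P))'\<close>, the two \<open>\<kappa>\<^sub>1\<close>-terms of each product cancel against \<open>E'\<close>, the terms
  \<open>D\<^sup>\<alpha>x Q\<close> and \<open>D\<^sup>\<alpha>y P\<close> cancel each other, and what remains is the Lagrange identity
  \<open>(E p W(x,y))' = (x Ly - y Lx) E/\<kappa>\<^sub>0\<close>.  Integrating it over \<open>[a,b]\<close> gives Green's formula.
\<close>

text \<open>The definition of \<open>conf_deriv\<close> is solved for the ordinary derivative, which
  needs \<open>k0 t \<noteq> 0\<close>. A derivative within \<open>I\<close> is also one within any
  \<open>S \<subseteq> I\<close>, so the fundamental theorem on \<open>{a..b}\<close> can use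
  it.\<close>

lemma conf_differentiable_on_DERIV:
  assumes "conf_differentiable_on I f" "S \<subseteq> I" "t \<in> S" "k0 t \<noteq> 0"
  shows "(f has_field_derivative (conf_deriv k0 k1 I f t - k1 t * f t) / k0 t) (at t within S)"
proof -
  have "(f has_vector_derivative vector_derivative f (at t within I)) (at t within I)"
    using assms by (auto simp: conf_differentiable_on_def vector_derivative_works)
  then have "(f has_field_derivative vector_derivative f (at t within I)) (at t within S)"
    using assms(2) has_vector_derivative_within_subset
    by (auto simp: has_real_derivative_iff_has_vector_derivative)
  with assms(4) show ?thesis by (simp add: conf_deriv_def)
qed

lemma conf_exp0_square_DERIV:
  assumes "continuous_on {a..b} k0" "continuous_on {a..b} k1"
    and nz: "\<And>t. t \<in> {a..b} \<Longrightarrow> k0 t \<noteq> 0" and t: "t \<in> {a..b}"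
  shows "((\<lambda>s. (conf_exp0 k0 k1 b s)\<^sup>2) has_field_derivative
           2 * (k1 t / k0 t) * (conf_exp0 k0 k1 b t)\<^sup>2) (at t within {a..b})"
proof -
  have "continuous_on {a..b} (\<lambda>s. k1 s / k0 s)"
    using assms by (intro continuous_intros) auto
  then have *: "((\<lambda>u. LBINT \<tau>=ereal b..ereal u. k1 \<tau> / k0 \<tau>)
      has_field_derivative k1 t / k0 t) (at t within {a..b})"
    unfolding has_real_derivative_iff_has_vector_derivative
    using t by (intro interval_integral_FTC2) auto
  \<comment> \<open>Here the variable is the lower limit of integration. Reversing the endpoints
    absorbs the minus sign of \<open>conf_exp0\<close> and makes it the upper limit, with base point
    \<open>b\<close>, as in \<open>*\<close>.\<close>
  have exp0: "conf_exp0 k0 k1 b = (\<lambda>u. exp (LBINT \<tau>=ereal b..ereal u. k1 \<tau> / k0 \<tau>))"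
    by (rule ext) (metis conf_exp0_def interval_integral_endpoints_reverse minus_minus)
  show ?thesis
    unfolding exp0
    by (rule DERIV_cong[OF DERIV_power[OF DERIV_chain2[OF DERIV_exp *]]])
       (simp add: power2_eq_square)
qed

text \<open>The derivative is left as a difference of two fractions because these are exactly the
  integrands of the two inner products in Green's formula.\<close>

lemma conf_lagrange_identity:
  assumes "continuous_on {a..b} k0" "continuous_on {a..b} k1"
    and nz: "\<And>t. t \<in> {a..b} \<Longrightarrow> k0 t \<noteq> 0" and sub: "{a..b} \<subseteq> I"
    and x: "x \<in> conf_domain k0 k1 I p" and y: "y \<in> conf_domain k0 k1 I p"
    and t: "t \<in> {a..b}"
  shows "((\<lambda>t. (conf_exp0 k0 k1 b t)\<^sup>2 * p t * conf_wronskian k0 k1 I x y t) has_field_derivative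
           x t * conf_L k0 k1 I p q y t * (conf_exp0 k0 k1 b t)\<^sup>2 / k0 t
           - conf_L k0 k1 I p q x t * y t * (conf_exp0 k0 k1 b t)\<^sup>2 / k0 t) (at t within {a..b})"
proof -
  define P where "P = (\<lambda>s. p s * conf_deriv k0 k1 I x s)"
  define Q where "Q = (\<lambda>s. p s * conf_deriv k0 k1 I y s)"
  note D = conf_differentiable_on_DERIV[where ?k0.0 = k0 and ?k1.0 = k1, OF _ sub t nz[OF t]]
  have Dx: "(x has_field_derivative (conf_deriv k0 k1 I x t - k1 t * x t) / k0 t) (at t within {a..b})"
    and Dy: "(y has_field_derivative (conf_deriv k0 k1 I y t - k1 t * y t) / k0 t) (at t within {a..b})"
    and DP: "(P has_field_derivative (conf_deriv k0 k1 I P t - k1 t * P t) / k0 t) (at t within {a..b})"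
    and DQ: "(Q has_field_derivative (conf_deriv k0 k1 I Q t - k1 t * Q t) / k0 t) (at t within {a..b})"
    using x y by (auto simp: conf_domain_def P_def Q_def intro!: D)
  \<comment> \<open>Differentiability is known for the products \<open>P\<close> and
    \<open>Q\<close>, not for \<open>p\<close> itself, so \<open>p\<close> is absorbed into them
    before the product rule is applied.\<close>
  have F: "(\<lambda>t. (conf_exp0 k0 k1 b t)\<^sup>2 * p t * conf_wronskian k0 k1 I x y t)
      = (\<lambda>t. (conf_exp0 k0 k1 b t)\<^sup>2 * (x t * Q t - y t * P t))"
    by (simp add: P_def Q_def conf_wronskian_def algebra_simps)
  have Lx: "conf_L k0 k1 I p q x t = conf_deriv k0 k1 I P t + q t * x t"
    and Ly: "conf_L k0 k1 I p q y t = conf_deriv k0 k1 I Q t + q t * y t"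
    by (simp_all add: conf_L_def P_def Q_def)
  have PQ: "conf_deriv k0 k1 I x t * Q t = conf_deriv k0 k1 I y t * P t"
    by (simp add: P_def Q_def)
  \<comment> \<open>The left side is what the product rule produces. With \<open>P\<close> and
    \<open>Q\<close> opaque, the cross terms remain as the last summand on the right, and the
    equation is a polynomial identity in the inverse of \<open>k0 t\<close> and the other
    quantities. \<open>PQ\<close> then makes that summand vanish.\<close>
  have eq: "2 * (k1 t / k0 t) * (conf_exp0 k0 k1 b t)\<^sup>2 * (x t * Q t - y t * P t)
      + ((conf_deriv k0 k1 I x t - k1 t * x t) / k0 t * Q t
          + (conf_deriv k0 k1 I Q t - k1 t * Q t) / k0 t * x t
          - ((conf_deriv k0 k1 I y t - k1 t * y t) / k0 t * P t
          + (conf_deriv k0 k1 I P t - k1 t * P t) / k0 t * y t)) * (conf_exp0 k0 k1 b t)\<^sup>2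
      = x t * (conf_deriv k0 k1 I Q t + q t * y t) * (conf_exp0 k0 k1 b t)\<^sup>2 / k0 t
        - (conf_deriv k0 k1 I P t + q t * x t) * y t * (conf_exp0 k0 k1 b t)\<^sup>2 / k0 t
        + (conf_deriv k0 k1 I x t * Q t - conf_deriv k0 k1 I y t * P t)
          * (conf_exp0 k0 k1 b t)\<^sup>2 / k0 t"
    by (simp add: divide_inverse algebra_simps)
  show ?thesis
    unfolding F Lx Ly
    by (rule DERIV_cong[OF DERIV_mult[OF conf_exp0_square_DERIV[OF assms(1,2) nz t]
          DERIV_diff[OF DERIV_mult[OF Dx DQ] DERIV_mult[OF Dy DP]]]])
       (assumption, rule eq[unfolded PQ diff_self mult_zero_left div_0 add_0_right])
qed

lemma conf_green_formula:
  assumes "a \<le> b" and k0: "continuous_on {a..b} k0" and k1: "continuous_on {a..b} k1"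
    and nz: "\<And>t. t \<in> {a..b} \<Longrightarrow> k0 t \<noteq> 0" and sub: "{a..b} \<subseteq> I"
    and q: "continuous_on {a..b} q"
    and x: "x \<in> conf_domain k0 k1 I p" and y: "y \<in> conf_domain k0 k1 I p"
  shows "conf_inner k0 k1 a b x (conf_L k0 k1 I p q y) - conf_inner k0 k1 a b (conf_L k0 k1 I p q x) y
    = eval_between (\<lambda>t. (conf_exp0 k0 k1 b t)\<^sup>2 * p t * conf_wronskian k0 k1 I x y t) a b"
proof -
  have E: "continuous_on {a..b} (\<lambda>t. (conf_exp0 k0 k1 b t)\<^sup>2)"
    by (rule DERIV_continuous_on[OF conf_exp0_square_DERIV[OF k0 k1 nz]])
  \<comment> \<open>Continuity of both integrands serves twice: it gives the integrability that
    allows the integrals to be subtracted, and the hypothesis of the fundamental theorem.\<close>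
  have cont: "continuous_on {a..b} f \<and> continuous_on {a..b} (conf_L k0 k1 I p q f)"
    if "f \<in> conf_domain k0 k1 I p" for f
  proof
    show f: "continuous_on {a..b} f"
      using that by (simp add: conf_domain_def continuous_on_subset[OF _ sub])
    have "continuous_on {a..b} (conf_deriv k0 k1 I (\<lambda>s. p s * conf_deriv k0 k1 I f s))"
      using that by (simp add: conf_domain_def continuous_on_subset[OF _ sub])
    then show "continuous_on {a..b} (conf_L k0 k1 I p q f)"
      unfolding conf_L_def [abs_def] by (intro continuous_on_add continuous_on_mult q f)
  qed
  define f where "f = (\<lambda>t. x t * conf_L k0 k1 I p q y t * (conf_exp0 k0 k1 b t)\<^sup>2 / k0 t)"
  define g where "g = (\<lambda>t. conf_L k0 k1 I p q x t * y t * (conf_exp0 k0 k1 b t)\<^sup>2 / k0 t)"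
  have f: "continuous_on {a..b} f" and g: "continuous_on {a..b} g"
    unfolding f_def g_def using cont[OF x] cont[OF y] E k0 nz
    by (simp_all add: continuous_on_mult continuous_on_divide)
  have "conf_inner k0 k1 a b x (conf_L k0 k1 I p q y) - conf_inner k0 k1 a b (conf_L k0 k1 I p q x) y
    = (LBINT t=ereal a..ereal b. f t - g t)"
    unfolding conf_inner_def f_def[symmetric] g_def[symmetric]
    by (rule interval_lebesgue_integral_diff(2)[symmetric])
       (simp_all add: \<open>a \<le> b\<close> f g interval_integrable_continuous_on)
  also have "\<dots> = eval_between
      (\<lambda>t. (conf_exp0 k0 k1 b t)\<^sup>2 * p t * conf_wronskian k0 k1 I x y t) a b"
    unfolding eval_between_def
  proof (rule interval_integral_FTC_finite)
    show "continuous_on {min a b..max a b} (\<lambda>t. f t - g t)"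
      using \<open>a \<le> b\<close> f g by (simp add: continuous_on_diff)
  next
    fix t assume "min a b \<le> t" "t \<le> max a b"
    then have "t \<in> {a..b}" using \<open>a \<le> b\<close> by simp
    from conf_lagrange_identity[OF k0 k1 nz sub x y this, where q = q] \<open>a \<le> b\<close>
    show "((\<lambda>t. (conf_exp0 k0 k1 b t)\<^sup>2 * p t * conf_wronskian k0 k1 I x y t)
        has_vector_derivative f t - g t) (at t within {min a b..max a b})"
      by (simp add: f_def g_def has_real_derivative_iff_has_vector_derivative)
  qed
  finally show ?thesis .
qed

theorem corollary3p8:
  fixes I :: "real set"
    and \<kappa>0 \<kappa>1 :: "real \<Rightarrow> real \<Rightarrow> real"
    and \<alpha> a b :: real
    and p q x y :: "real \<Rightarrow> real"
  assumes "is_interval I" and "\<exists>u\<in>I. \<exists>v\<in>I. u < v"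
    and "continuous_on ({0..1} \<times> I) (\<lambda>(\<beta>, t). \<kappa>0 \<beta> t)"
    and "continuous_on ({0..1} \<times> I) (\<lambda>(\<beta>, t). \<kappa>1 \<beta> t)"
    and "\<And>\<beta> t. \<beta> \<in> {0..1} \<Longrightarrow> t \<in> I \<Longrightarrow> \<kappa>0 \<beta> t \<ge> 0"
    and "\<And>\<beta> t. \<beta> \<in> {0..1} \<Longrightarrow> t \<in> I \<Longrightarrow> \<kappa>1 \<beta> t \<ge> 0"
    and "\<And>t. t \<in> I \<Longrightarrow> ((\<lambda>\<beta>. \<kappa>1 \<beta> t) \<longlongrightarrow> 1) (at_right 0)"
    and "\<And>t. t \<in> I \<Longrightarrow> ((\<lambda>\<beta>. \<kappa>0 \<beta> t) \<longlongrightarrow> 0) (at_right 0)"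
    and "\<And>t. t \<in> I \<Longrightarrow> ((\<lambda>\<beta>. \<kappa>1 \<beta> t) \<longlongrightarrow> 0) (at_left 1)"
    and "\<And>t. t \<in> I \<Longrightarrow> ((\<lambda>\<beta>. \<kappa>0 \<beta> t) \<longlongrightarrow> 1) (at_left 1)"
    and "\<And>\<beta> t. \<beta> \<in> {0..<1} \<Longrightarrow> t \<in> I \<Longrightarrow> \<kappa>1 \<beta> t \<noteq> 0"
    and "\<And>\<beta> t. \<beta> \<in> {0<..1} \<Longrightarrow> t \<in> I \<Longrightarrow> \<kappa>0 \<beta> t \<noteq> 0"
    and "\<alpha> \<in> {0<..1}"
    and "continuous_on I p" and "continuous_on I q"
    and "\<And>t. t \<in> I \<Longrightarrow> p t > 0"
    and "a < b" and "{a..b} \<subseteq> I"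
    and "x \<in> conf_domain (\<kappa>0 \<alpha>) (\<kappa>1 \<alpha>) I p"
    and "y \<in> conf_domain (\<kappa>0 \<alpha>) (\<kappa>1 \<alpha>) I p"
  shows "(conf_inner (\<kappa>0 \<alpha>) (\<kappa>1 \<alpha>) a b x (conf_L (\<kappa>0 \<alpha>) (\<kappa>1 \<alpha>) I p q y)
            - conf_inner (\<kappa>0 \<alpha>) (\<kappa>1 \<alpha>) a b (conf_L (\<kappa>0 \<alpha>) (\<kappa>1 \<alpha>) I p q x) y
          = eval_between
              (\<lambda>t. (conf_exp0 (\<kappa>0 \<alpha>) (\<kappa>1 \<alpha>) b t)\<^sup>2 * p t * conf_wronskian (\<kappa>0 \<alpha>) (\<kappa>1 \<alpha>) I x y t) a b)
       \<and> (conf_inner (\<kappa>0 \<alpha>) (\<kappa>1 \<alpha>) a b (conf_L (\<kappa>0 \<alpha>) (\<kappa>1 \<alpha>) I p q x) y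
            = conf_inner (\<kappa>0 \<alpha>) (\<kappa>1 \<alpha>) a b x (conf_L (\<kappa>0 \<alpha>) (\<kappa>1 \<alpha>) I p q y)
          \<longleftrightarrow> eval_between
              (\<lambda>t. (conf_exp0 (\<kappa>0 \<alpha>) (\<kappa>1 \<alpha>) b t)\<^sup>2 * p t * conf_wronskian (\<kappa>0 \<alpha>) (\<kappa>1 \<alpha>) I x y t) a b = 0)"
proof -
  \<comment> \<open>Joint continuity is composed with \<open>t \<mapsto> (\<alpha>, t)\<close>,
    which maps \<open>{a..b}\<close> into \<open>{0..1} \<times> I\<close>.\<close>
  have slice: "continuous_on {a..b} (\<kappa> \<alpha>)"
    if "continuous_on ({0..1} \<times> I) (\<lambda>(\<beta>, t). \<kappa> \<beta> t)" for \<kappa> :: "real \<Rightarrow> real \<Rightarrow> real"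
  proof -
    have "continuous_on {a..b} (\<lambda>t. case (\<alpha>, t) of (\<beta>, t) \<Rightarrow> \<kappa> \<beta> t)"
      using assms(13,18)
      by (intro continuous_on_compose2[OF that] continuous_intros) auto
    then show ?thesis by simp
  qed
  have "conf_inner (\<kappa>0 \<alpha>) (\<kappa>1 \<alpha>) a b x (conf_L (\<kappa>0 \<alpha>) (\<kappa>1 \<alpha>) I p q y)
      - conf_inner (\<kappa>0 \<alpha>) (\<kappa>1 \<alpha>) a b (conf_L (\<kappa>0 \<alpha>) (\<kappa>1 \<alpha>) I p q x) y
      = eval_between
          (\<lambda>t. (conf_exp0 (\<kappa>0 \<alpha>) (\<kappa>1 \<alpha>) b t)\<^sup>2 * p t * conf_wronskian (\<kappa>0 \<alpha>) (\<kappa>1 \<alpha>) I x y t) a b"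
  proof (rule conf_green_formula)
    show "\<kappa>0 \<alpha> t \<noteq> 0" if "t \<in> {a..b}" for t
      using assms(12)[OF assms(13)] assms(18) that by blast
    show "continuous_on {a..b} q"
      using assms(15,18) by (rule continuous_on_subset)
  qed (use assms in \<open>auto intro!: slice\<close>)
  \<comment> \<open>The equivalence is read off Green's formula: the two inner products agree
    exactly when their difference, the boundary term, is zero.\<close>
  then show ?thesis by auto
qed

end
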